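(* Let $\alpha,\beta\in\mathbb{R}$ and $\eta\in\{1,-1\}$, and let $(G_4,g,J)$ be the connected, simply connected three-dimensional Lie group with left-invariant Lorentzian metric $g$ whose Lie algebra $\mathfrak{g}$ has a pseudo-orthonormal basis $\{e_1,e_2,e_3\}$ with $e_3$ timelike such that $$[e_1,e_2]=-e_2+(2\eta-\beta)e_3,\quad [e_1,e_3]=-\beta e_2+e_3,\quad [e_2,e_3]=\alpha e_1,$$ equipped with the product structure $Je_1=e_1$, $Je_2=e_2$, $Je_3=-e_3$. Let $c\in\mathbb{R}$. Then $(G_4,g,J)$ is a second kind algebraic Wanas soliton associated to the canonical connection $\nabla^0$ with constant $c$ (i.e. $\widetilde{\mathrm{Wan}}^0=c\,\mathrm{Id}+D$ with $D$ a derivation of $\mathfrak g$) if and only if one of the following holds: (i) $\alpha=0$, $\beta=\eta$, $c=-1$; in particular $De_1=0$, $De_2=-e_2+\eta e_3$, $De_3=-\eta e_2+e_3$. (ii) $\alpha=0$, $\beta=-\eta$, $c=-11$; in particular $De_1=0$, $De_2=7e_2$, $De_3=7e_3$.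
   Context: Pseudo-orthonormal with $e_3$ timelike means $g(e_1,e_1)=g(e_2,e_2)=1$, $g(e_3,e_3)=-1$, $g(e_i,e_j)=0$ for $i\ne j$. All tensors are left-invariant and evaluated on the Lie algebra $\mathfrak{g}$ of left-invariant vector fields. Let $\nabla$ be the Levi-Civita connection of $g$, and let $J$ be the product structure given in the claim, with $(\nabla_XJ)Y=\nabla_X(JY)-J(\nabla_XY)$. Canonical connection: $\nabla^0_XY=\nabla_XY-\frac12(\nabla_XJ)JY$. Curvature: $R^0(X,Y)Z=\nabla^0_X\nabla^0_YZ-\nabla^0_Y\nabla^0_XZ-\nabla^0_{[X,Y]}Z$. Torsion: $T^0(X,Y)=\nabla^0_XY-\nabla^0_YX-[X,Y]$. $A^0(X,Y)Z=T^0(T^0(X,Y),Z)$, and the Wanas tensor is $W^0(X,Y)Z=R^0(X,Y)Z-A^0(X,Y)Z$. $w^0(X,Y)=-g(W^0(X,e_1)Y,e_1)-g(W^0(X,e_2)Y,e_2)+g(W^0(X,e_3)Y,e_3)$. $\widetilde w^0(X,Y)=\frac12\big(w^0(X,Y)+w^0(Y,X)\big)$, and the operator $\widetilde{\mathrm{Wan}}^0:\mathfrak g\to\mathfrak g$ is defined by $\widetilde w^0(X,Y)=g(\widetilde{\mathrm{Wan}}^0(X),Y)$. A derivation of $\mathfrak g$ is a linear map $D$ with $D[X,Y]=[DX,Y]+[X,DY]$ for all $X,Y\in\mathfrak g$. $(G_4,g,J)$ is a second kind algebraic Wanas soliton associated to $\nabla^0$ (with constant $c$) if $\widetilde{\mathrm{Wan}}^0=c\,\mathrm{Id}+D$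 for the real number $c$ and a derivation $D$ of $\mathfrak g$. *)

theory Defs
  imports "HOL-Analysis.Analysis"
begin

text \<open>
  A connected, simply connected Lie group with left-invariant structure is represented by its
  Lie algebra: a real vector space with a Lie bracket \<open>br\<close>, a scalar product \<open>g\<close> and a linear map
  \<open>J\<close>. The vectors are the left-invariant vector fields, and the connections and tensors below are
  the left-invariant ones, evaluated on such fields.
\<close>

definition lie_bracket :: "('a::real_vector \<Rightarrow> 'a \<Rightarrow> 'a) \<Rightarrow> bool" where
  "lie_bracket br \<longleftrightarrow>
     bilinear br \<and> (\<forall>X. br X X = 0) \<and>
     (\<forall>X Y Z. br X (br Y Z) + br Y (br Z X) + br Z (br X Y) = 0)"

definition derivation :: "('a::real_vector \<Rightarrow> 'a \<Rightarrow> 'a) \<Rightarrow> ('a \<Rightarrow> 'a) \<Rightarrow> bool" where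
  "derivation br D \<longleftrightarrow> linear D \<and> (\<forall>X Y. D (br X Y) = br (D X) Y + br X (D Y))"

definition symmetric_form :: "('a::real_vector \<Rightarrow> 'a \<Rightarrow> real) \<Rightarrow> bool" where
  "symmetric_form g \<longleftrightarrow> bilinear g \<and> (\<forall>X Y. g X Y = g Y X)"

text \<open>
  Pseudo-orthonormal with \<open>e3\<close> timelike. A symmetric form admitting such a basis is nondegenerate
  of signature \<open>(2,1)\<close>, that is, Lorentzian.
\<close>

definition pseudo_orthonormal_basis ::
    "('a::real_vector \<Rightarrow> 'a \<Rightarrow> real) \<Rightarrow> 'a \<Rightarrow> 'a \<Rightarrow> 'a \<Rightarrow> bool" where
  "pseudo_orthonormal_basis g e1 e2 e3 \<longleftrightarrow>
     independent {e1, e2, e3} \<and> span {e1, e2, e3} = UNIV \<and>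
     g e1 e1 = 1 \<and> g e2 e2 = 1 \<and> g e3 e3 = -1 \<and>
     g e1 e2 = 0 \<and> g e1 e3 = 0 \<and> g e2 e3 = 0"

text \<open>
  The unique torsion-free metric connection. On left-invariant fields \<open>g Y Z\<close> is a constant
  function, so the term \<open>X (g Y Z)\<close> in the metric condition vanishes.
\<close>

definition levi_civita ::
    "('a::real_vector \<Rightarrow> 'a \<Rightarrow> 'a) \<Rightarrow> ('a \<Rightarrow> 'a \<Rightarrow> real) \<Rightarrow> 'a \<Rightarrow> 'a \<Rightarrow> 'a" where
  "levi_civita br g =
     (THE N. bilinear N \<and>
        (\<forall>X Y. N X Y - N Y X = br X Y) \<and>
        (\<forall>X Y Z. g (N X Y) Z + g Y (N X Z) = 0))"

definition cov_deriv_endo ::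
    "('a::real_vector \<Rightarrow> 'a \<Rightarrow> 'a) \<Rightarrow> ('a \<Rightarrow> 'a) \<Rightarrow> 'a \<Rightarrow> 'a \<Rightarrow> 'a" where
  "cov_deriv_endo N J X Y = N X (J Y) - J (N X Y)"

definition canonical_connection ::
    "('a::real_vector \<Rightarrow> 'a \<Rightarrow> 'a) \<Rightarrow> ('a \<Rightarrow> 'a \<Rightarrow> real) \<Rightarrow> ('a \<Rightarrow> 'a) \<Rightarrow> 'a \<Rightarrow> 'a \<Rightarrow> 'a" where
  "canonical_connection br g J X Y =
     levi_civita br g X Y - (1/2) *\<^sub>R cov_deriv_endo (levi_civita br g) J X (J Y)"

definition curvature ::
    "('a::real_vector \<Rightarrow> 'a \<Rightarrow> 'a) \<Rightarrow> ('a \<Rightarrow> 'a \<Rightarrow> 'a) \<Rightarrow> 'a \<Rightarrow> 'a \<Rightarrow> 'a \<Rightarrow> 'a" where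
  "curvature br N X Y Z = N X (N Y Z) - N Y (N X Z) - N (br X Y) Z"

definition torsion ::
    "('a::real_vector \<Rightarrow> 'a \<Rightarrow> 'a) \<Rightarrow> ('a \<Rightarrow> 'a \<Rightarrow> 'a) \<Rightarrow> 'a \<Rightarrow> 'a \<Rightarrow> 'a" where
  "torsion br N X Y = N X Y - N Y X - br X Y"

definition wanas_tensor ::
    "('a::real_vector \<Rightarrow> 'a \<Rightarrow> 'a) \<Rightarrow> ('a \<Rightarrow> 'a \<Rightarrow> 'a) \<Rightarrow> 'a \<Rightarrow> 'a \<Rightarrow> 'a \<Rightarrow> 'a" where
  "wanas_tensor br N X Y Z =
     curvature br N X Y Z - torsion br N (torsion br N X Y) Z"

definition wanas_form ::
    "('a::real_vector \<Rightarrow> 'a \<Rightarrow> 'a) \<Rightarrow> ('a \<Rightarrow> 'a \<Rightarrow> real) \<Rightarrow> ('a \<Rightarrow> 'a) \<Rightarrow>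
     'a \<Rightarrow> 'a \<Rightarrow> 'a \<Rightarrow> 'a \<Rightarrow> 'a \<Rightarrow> real" where
  "wanas_form br g J e1 e2 e3 X Y =
     (let W = wanas_tensor br (canonical_connection br g J)
      in - g (W X e1 Y) e1 - g (W X e2 Y) e2 + g (W X e3 Y) e3)"

definition sym_wanas_form ::
    "('a::real_vector \<Rightarrow> 'a \<Rightarrow> 'a) \<Rightarrow> ('a \<Rightarrow> 'a \<Rightarrow> real) \<Rightarrow> ('a \<Rightarrow> 'a) \<Rightarrow>
     'a \<Rightarrow> 'a \<Rightarrow> 'a \<Rightarrow> 'a \<Rightarrow> 'a \<Rightarrow> real" where
  "sym_wanas_form br g J e1 e2 e3 X Y =
     (1/2) * (wanas_form br g J e1 e2 e3 X Y + wanas_form br g J e1 e2 e3 Y X)"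

text \<open>The operator is determined by the symmetrised form because \<open>g\<close> is nondegenerate.\<close>

definition wanas_operator ::
    "('a::real_vector \<Rightarrow> 'a \<Rightarrow> 'a) \<Rightarrow> ('a \<Rightarrow> 'a \<Rightarrow> real) \<Rightarrow> ('a \<Rightarrow> 'a) \<Rightarrow>
     'a \<Rightarrow> 'a \<Rightarrow> 'a \<Rightarrow> 'a \<Rightarrow> 'a" where
  "wanas_operator br g J e1 e2 e3 =
     (THE S. \<forall>X Y. sym_wanas_form br g J e1 e2 e3 X Y = g (S X) Y)"

definition wanas_decomposition ::
    "('a::real_vector \<Rightarrow> 'a \<Rightarrow> 'a) \<Rightarrow> ('a \<Rightarrow> 'a \<Rightarrow> real) \<Rightarrow> ('a \<Rightarrow> 'a) \<Rightarrow>
     'a \<Rightarrow> 'a \<Rightarrow> 'a \<Rightarrow> real \<Rightarrow> ('a \<Rightarrow> 'a) \<Rightarrow> bool" where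
  "wanas_decomposition br g J e1 e2 e3 c D \<longleftrightarrow>
     derivation br D \<and> (\<forall>X. wanas_operator br g J e1 e2 e3 X = c *\<^sub>R X + D X)"

definition second_kind_wanas_soliton ::
    "('a::real_vector \<Rightarrow> 'a \<Rightarrow> 'a) \<Rightarrow> ('a \<Rightarrow> 'a \<Rightarrow> real) \<Rightarrow> ('a \<Rightarrow> 'a) \<Rightarrow>
     'a \<Rightarrow> 'a \<Rightarrow> 'a \<Rightarrow> real \<Rightarrow> bool" where
  "second_kind_wanas_soliton br g J e1 e2 e3 c \<longleftrightarrow>
     (\<exists>D. wanas_decomposition br g J e1 e2 e3 c D)"

end

theory Submission
  imports Defs
begin

text \<open>
  In the coordinates of the frame, the Levi-Civita connection comes from the Koszul formula, and
  the canonical connection is \<open>\<nabla>\<^sup>0 X Y = \<theta>(X) (y\<^sub>1 e\<^sub>2 - y\<^sub>2 e\<^sub>1)\<close> with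
  \<open>\<theta>(X) = x\<^sub>2 + (\<eta> + \<alpha>/2) x\<^sub>3\<close>. The Wanas operator then scales \<open>e\<^sub>1\<close> and preserves the plane of
  \<open>e\<^sub>2, e\<^sub>3\<close>, so being a derivation after subtracting \<open>c Id\<close> amounts to four polynomial equations.
  These determine \<open>c\<close>; for \<open>\<alpha> = 0\<close> they reduce to \<open>(\<eta>\<beta> - 1)\<^sup>2 (\<eta>\<beta> + 1) = 0\<close>, and for \<open>\<alpha> \<noteq> 0\<close> they
  force \<open>\<eta>\<beta> = 1\<close> or \<open>\<eta>\<alpha> = 3 - \<eta>\<beta>\<close>, both of which are contradictory.
\<close>

section \<open>Uniqueness of the Levi-Civita connection\<close>

lemma levi_civita_eqI:
  assumes sym: "symmetric_form g"
    and nondeg: "\<And>U V. (\<And>Z. g U Z = g V Z) \<Longrightarrow> U = V"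
    and bil: "bilinear N"
    and tf: "\<And>X Y. N X Y - N Y X = br X Y"
    and metric: "\<And>X Y Z. g (N X Y) Z + g Y (N X Z) = 0"
  shows "levi_civita br g = N"
  unfolding levi_civita_def
proof (rule the_equality)
  show "bilinear N \<and> (\<forall>X Y. N X Y - N Y X = br X Y) \<and>
      (\<forall>X Y Z. g (N X Y) Z + g Y (N X Z) = 0)"
    using bil tf metric by blast
next
  fix M
  assume M: "bilinear M \<and> (\<forall>X Y. M X Y - M Y X = br X Y) \<and>
      (\<forall>X Y Z. g (M X Y) Z + g Y (M X Z) = 0)"
  have g: "bilinear g" and comm: "g X Y = g Y X" for X Y
    using sym by (auto simp: symmetric_form_def)
  have koszul: "2 * g (K X Y) Z = g (br X Y) Z - g (br Y Z) X + g (br Z X) Y"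
    if K: "\<And>X Y. K X Y - K Y X = br X Y" "\<And>X Y Z. g (K X Y) Z + g Y (K X Z) = 0" for K X Y Z
  proof -
    have tf': "g (br U V) W = g (K U V) W - g (K V U) W" for U V W
      by (simp flip: K(1) add: bilinear_lsub[OF g])
    have skew: "g (K U V) W = - g (K U W) V" for U V W
      using K(2)[of U V W] comm[of V "K U W"] by simp
    \<comment> \<open>Metric compatibility cancels the terms of \<open>K Y\<close> and
      \<open>K Z\<close> in pairs and doubles the one of \<open>K X\<close>. The derivative terms of
      the usual Koszul formula are absent because \<open>g\<close> is constant on left-invariant
      fields.\<close>
    show ?thesis
      using skew[of X Y Z] skew[of Y X Z] skew[of Z X Y] by (simp add: tf')
  qed
  show "M = N"
  proof (intro ext nondeg)
    fix X Y Z
    show "g (M X Y) Z = g (N X Y) Z"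
      using koszul[of M X Y Z] koszul[of N X Y Z] M tf metric by simp
  qed
qed

section \<open>The polynomial system for the soliton\<close>

text \<open>The case \<open>\<eta> = 1\<close>; the equations are invariant under changing the signs of \<open>\<alpha>, \<beta>, \<eta>\<close> together.\<close>

lemma soliton_equations_imp:
  fixes a b c :: real
  defines "s1 \<equiv> -4 + 5 * b - 2 * b\<^sup>2 - a + a * b / 2"
    and "s2 \<equiv> -3 + 3 * a - 3/2 * a * b + b"
    and "s3 \<equiv> -2 + a\<^sup>2 / 2 - a * b + 2 * b"
    and "t \<equiv> - 3/4 * a + 1 / 2 + b / 2"
  assumes "s1 - c = 2 * t * (1 - b)"
    and "2 * t = (2 - b) * (s3 - s1 - s2 + c)"
    and "2 * t = b * (s1 + s3 - s2 - c)"
    and "a * (s2 + s3 - s1 - c) = 0"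
  shows "a = 0 \<and> (b = 1 \<and> c = -1 \<or> b = -1 \<and> c = -11)"
proof -
  \<comment> \<open>The first equation is linear in \<open>c\<close>; eliminating \<open>c\<close>
    leaves three polynomials in \<open>a\<close> and \<open>b\<close>.\<close>
  have c: "c = s1 - 2 * t * (1 - b)"
    using assms(5) by simp
  have p: "- 3 * a - 2 + 2 * b + 2 * a\<^sup>2 - a * b - a\<^sup>2 * b + 2 * b\<^sup>2 - 2 * b^3 + 2 * a * b\<^sup>2 = 0"
    using assms(6) unfolding c s1_def s2_def s3_def t_def
    by (simp add: field_simps power2_eq_square power3_eq_cube)
  have q: "3 * a - 2 + 2 * b - 9 * a * b + 4 * a * b\<^sup>2 + 2 * b\<^sup>2 - 2 * b^3 + a\<^sup>2 * b = 0"
    using assms(7) unfolding c s1_def s2_def s3_def t_def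
    by (simp add: field_simps power2_eq_square power3_eq_cube)
  have r: "a * (- 8 + 14 * b - 6 * b\<^sup>2 - 7 * a + 4 * a * b - a\<^sup>2) = 0"
    using assms(8) unfolding c s1_def s2_def s3_def t_def
    by (simp add: field_simps power2_eq_square power3_eq_cube)
  have "a = 0"
  proof (rule ccontr)
    assume "a \<noteq> 0"
    then have r': "- 8 + 14 * b - 6 * b\<^sup>2 - 7 * a + 4 * a * b - a\<^sup>2 = 0"
      using r by simp
    \<comment> \<open>The left sides of \<open>p\<close> and \<open>q\<close> differ by exactly -2
      times this product.\<close>
    have "a * ((b - 1) * (a - (3 - b))) = 0"
      using p q by algebra
    then consider "b = 1" | "a = 3 - b"
      using \<open>a \<noteq> 0\<close> by auto
    then show False
    proof cases
      case 1
      then have "a * (a + 3) = 0"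
        using r' by algebra
      then have "a = -3"
        using \<open>a \<noteq> 0\<close> by simp
      then show False
        using p 1 by simp
    next
      case 2
      then have "11 * b\<^sup>2 - 39 * b + 38 = 0"
        using r' by algebra
      \<comment> \<open>Completing the square shows that the quadratic is positive.\<close>
      moreover have "11 * b\<^sup>2 - 39 * b + 38 = 11 * (b - 39/22)\<^sup>2 + 151/44"
        by (simp add: power2_eq_square field_simps)
      ultimately show False
        using zero_le_power2[of "b - 39/22"] by linarith
    qed
  qed
  then have "(b - 1)\<^sup>2 * (b + 1) = 0"
    using p by algebra
  then have "b = 1 \<or> b = -1"
    by (auto simp: eq_neg_iff_add_eq_0)
  then show ?thesis
    using \<open>a = 0\<close> c by (auto simp: s1_def t_def)
qed

lemma soliton_equations_iff:
  fixes \<alpha> \<beta> \<eta> c :: real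
  assumes "\<eta> \<in> {1, -1}"
  defines "s1 \<equiv> -4 + 5 * \<eta> * \<beta> - 2 * \<beta>\<^sup>2 - \<eta> * \<alpha> + \<alpha> * \<beta> / 2"
    and "s2 \<equiv> -3 + 3 * \<eta> * \<alpha> - 3/2 * \<alpha> * \<beta> + \<eta> * \<beta>"
    and "s3 \<equiv> -2 + \<alpha>\<^sup>2 / 2 - \<alpha> * \<beta> + 2 * \<eta> * \<beta>"
    and "t \<equiv> - 3/4 * \<alpha> + \<eta> / 2 + \<beta> / 2"
  shows "s1 - c = 2 * t * (\<eta> - \<beta>) \<and>
      2 * t = (2 * \<eta> - \<beta>) * (s3 - s1 - s2 + c) \<and>
      2 * t = \<beta> * (s1 + s3 - s2 - c) \<and>
      \<alpha> * (s2 + s3 - s1 - c) = 0 \<longleftrightarrow>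
    (\<alpha> = 0 \<and> \<beta> = \<eta> \<and> c = -1) \<or> (\<alpha> = 0 \<and> \<beta> = - \<eta> \<and> c = -11)"
    (is "?E \<longleftrightarrow> ?R")
proof
  assume E: ?E
  consider "\<eta> = 1" | "\<eta> = -1"
    using assms(1) by auto
  then show ?R
  proof cases
    case 1
    then show ?thesis
      using E soliton_equations_imp[of \<beta> \<alpha> c] by (simp add: s1_def s2_def s3_def t_def)
  next
    case 2
    \<comment> \<open>Under the common sign change \<open>s1\<close>, \<open>s2\<close>,
      \<open>s3\<close> are even and \<open>t\<close> is odd, so each equation goes over, up to
      sign, to the one with \<eta> = 1.\<close>
    have "- \<alpha> = 0 \<and> (- \<beta> = 1 \<and> c = -1 \<or> - \<beta> = -1 \<and> c = -11)"
    proof (rule soliton_equations_imp[where a = "- \<alpha>" and b = "- \<beta>"], goal_cases)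
      case 1
      show ?case
        using E[THEN conjunct1] by (simp add: s1_def t_def \<open>\<eta> = -1\<close> field_simps)
    next
      case 2
      show ?case
        using E[THEN conjunct2, THEN conjunct1]
        by (simp add: s1_def s2_def s3_def t_def \<open>\<eta> = -1\<close> field_simps)
    next
      case 3
      show ?case
        using E[THEN conjunct2, THEN conjunct2, THEN conjunct1]
        by (simp add: s1_def s2_def s3_def t_def \<open>\<eta> = -1\<close> field_simps)
    next
      case 4
      show ?case
        using E[THEN conjunct2, THEN conjunct2, THEN conjunct2]
        by (simp add: s1_def s2_def s3_def t_def \<open>\<eta> = -1\<close> field_simps)
    qed
    then show ?thesis
      using 2 by auto
  qed
next
  assume ?R
  then show ?E
    using assms(1) by (auto simp: s1_def s2_def s3_def t_def)
qed

section \<open>Coordinates in a pseudo-orthonormal frame\<close>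

locale pseudo_orthonormal_frame =
  fixes g :: "'a::real_vector \<Rightarrow> 'a \<Rightarrow> real"
    and e1 e2 e3 :: 'a
  assumes sym: "symmetric_form g"
    and basis: "pseudo_orthonormal_basis g e1 e2 e3"
begin

definition vec :: "real \<Rightarrow> real \<Rightarrow> real \<Rightarrow> 'a" where
  "vec x y z = x *\<^sub>R e1 + y *\<^sub>R e2 + z *\<^sub>R e3"

lemma vec_unit: "vec 1 0 0 = e1" "vec 0 1 0 = e2" "vec 0 0 1 = e3"
  by (simp_all add: vec_def)

lemma vec_add: "vec x y z + vec x' y' z' = vec (x + x') (y + y') (z + z')"
  and vec_diff: "vec x y z - vec x' y' z' = vec (x - x') (y - y') (z - z')"
  and vec_scaleR: "r *\<^sub>R vec x y z = vec (r * x) (r * y) (r * z)"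
  by (simp_all add: vec_def algebra_simps)

lemmas vec_arith = vec_add vec_diff vec_scaleR

lemma linear_vec:
  assumes "linear f"
  shows "f (vec x y z) = x *\<^sub>R f e1 + y *\<^sub>R f e2 + z *\<^sub>R f e3"
  by (simp add: vec_def linear_add[OF assms] linear_scale[OF assms])

lemma bilinear_vec:
  assumes "bilinear f"
  shows "f (vec x y z) (vec x' y' z') =
      (x * x') *\<^sub>R f e1 e1 + (x * y') *\<^sub>R f e1 e2 + (x * z') *\<^sub>R f e1 e3 +
      (y * x') *\<^sub>R f e2 e1 + (y * y') *\<^sub>R f e2 e2 + (y * z') *\<^sub>R f e2 e3 +
      (z * x') *\<^sub>R f e3 e1 + (z * y') *\<^sub>R f e3 e2 + (z * z') *\<^sub>R f e3 e3"
  by (simp add: vec_def bilinear_ladd[OF assms] bilinear_radd[OF assms]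
      bilinear_lmul[OF assms] bilinear_rmul[OF assms] algebra_simps)

lemma g_vec: "g (vec x y z) (vec x' y' z') = x * x' + y * y' - z * z'"
proof -
  have "bilinear g" "g e2 e1 = 0" "g e3 e1 = 0" "g e3 e2 = 0"
    using sym basis by (metis symmetric_form_def pseudo_orthonormal_basis_def)+
  then show ?thesis
    using basis by (simp add: bilinear_vec pseudo_orthonormal_basis_def)
qed

lemma vec_cases:
  obtains x y z where "X = vec x y z"
proof -
  have "X \<in> span {e1, e2, e3}"
    using basis by (simp add: pseudo_orthonormal_basis_def)
  then obtain x y z where "X - x *\<^sub>R e1 - y *\<^sub>R e2 = z *\<^sub>R e3"
    by (auto simp: span_insert[of e1] span_insert[of e2] span_singleton)
  then have "X = vec x y z"
    by (simp add: vec_def algebra_simps)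
  then show thesis
    by (rule that)
qed

lemma vec_eq_iff: "vec x y z = vec x' y' z' \<longleftrightarrow> x = x' \<and> y = y' \<and> z = z'"
proof
  assume eq: "vec x y z = vec x' y' z'"
  have "g (vec x y z) e = g (vec x' y' z') e" for e
    by (simp add: eq)
  from this[of "vec 1 0 0"] this[of "vec 0 1 0"] this[of "vec 0 0 1"]
  show "x = x' \<and> y = y' \<and> z = z'"
    by (simp add: g_vec)
qed simp

lemma g_nondegenerate:
  assumes "\<And>Z. g U Z = g V Z"
  shows "U = V"
proof -
  obtain x y z x' y' z' where UV: "U = vec x y z" "V = vec x' y' z'"
    by (metis vec_cases)
  from assms[of "vec 1 0 0"] assms[of "vec 0 1 0"] assms[of "vec 0 0 1"]
  show ?thesis
    by (simp add: UV g_vec)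
qed

text \<open>Pairing with the frame reads off coordinates; the sign in \<open>coord3\<close>
  compensates for \<open>g e3 e3 = -1\<close>.\<close>

definition coord1 where "coord1 X = g X (vec 1 0 0)"
definition coord2 where "coord2 X = g X (vec 0 1 0)"
definition coord3 where "coord3 X = - g X (vec 0 0 1)"

lemma coord_vec [simp]:
  "coord1 (vec x y z) = x" "coord2 (vec x y z) = y" "coord3 (vec x y z) = z"
  by (simp_all add: coord1_def coord2_def coord3_def g_vec)

end

section \<open>The Lie algebra of the group and its two connections\<close>

locale lorentzian_G4 = pseudo_orthonormal_frame g e1 e2 e3
  for g :: "'a::real_vector \<Rightarrow> 'a \<Rightarrow> real" and e1 e2 e3 :: 'a +
  fixes br :: "'a \<Rightarrow> 'a \<Rightarrow> 'a"
    and J :: "'a \<Rightarrow> 'a"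
    and \<alpha> \<beta> \<eta> :: real
  assumes eta: "\<eta> \<in> {1, -1}"
    and lie: "lie_bracket br"
    and br12: "br e1 e2 = - e2 + (2 * \<eta> - \<beta>) *\<^sub>R e3"
    and br13: "br e1 e3 = - (\<beta> *\<^sub>R e2) + e3"
    and br23: "br e2 e3 = \<alpha> *\<^sub>R e1"
    and linear_J: "linear J"
    and J_basis: "J e1 = e1" "J e2 = e2" "J e3 = - e3"
begin

lemma br_vec:
  "br (vec x y z) (vec x' y' z') =
     vec (\<alpha> * (y * z' - z * y'))
         (- (x * y' - y * x') - \<beta> * (x * z' - z * x'))
         ((2 * \<eta> - \<beta>) * (x * y' - y * x') + (x * z' - z * x'))"
proof -
  have bil: "bilinear br" and alt: "br X X = 0" for X
    using lie by (auto simp: lie_bracket_def)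
  have skew: "br Y X = - br X Y" for X Y
  proof -
    have "br (X + Y) (X + Y) = br X Y + br Y X"
      by (simp add: bilinear_ladd[OF bil] bilinear_radd[OF bil] alt[of X] alt[of Y])
    then show ?thesis
      by (metis alt add.commute eq_neg_iff_add_eq_0)
  qed
  have "br e2 e1 = - br e1 e2" "br e3 e1 = - br e1 e3" "br e3 e2 = - br e2 e3"
    by (rule skew)+
  then show ?thesis
    by (simp add: bilinear_vec[OF bil] alt br12 br13 br23) (simp add: vec_def algebra_simps)
qed

lemma J_vec: "J (vec x y z) = vec x y (- z)"
  by (simp add: linear_vec[OF linear_J] J_basis) (simp add: vec_def)

text \<open>This is the solution of the Koszul formula: \<open>p\<close> is the boost rate of
  \<open>e2\<close>, \<open>e3\<close> along \<open>e1\<close>, while \<open>q\<close> and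
  \<open>r\<close> appear in \<open>nabla e2 e1 = e2 + q e3\<close> and
  \<open>nabla e3 e1 = r e2 - e3\<close>.\<close>

definition nabla :: "'a \<Rightarrow> 'a \<Rightarrow> 'a" where
  "nabla X Y =
     (let x = coord1 X; y = coord2 X; z = coord3 X; x' = coord1 Y; y' = coord2 Y; z' = coord3 Y;
          p = \<eta> + \<alpha> / 2 - \<beta>; q = \<alpha> / 2 - \<eta>; r = \<eta> + \<alpha> / 2
      in vec (- (y * y') + q * y * z' - r * z * y' - z * z')
             (p * x * z' + y * x' + r * z * x')
             (p * x * y' + q * y * x' - z * x'))"

lemma nabla_vec:
  "nabla (vec x y z) (vec x' y' z') =
     vec (- (y * y') + (\<alpha> / 2 - \<eta>) * y * z' - (\<eta> + \<alpha> / 2) * z * y' - z * z')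
         ((\<eta> + \<alpha> / 2 - \<beta>) * x * z' + y * x' + (\<eta> + \<alpha> / 2) * z * x')
         ((\<eta> + \<alpha> / 2 - \<beta>) * x * y' + (\<alpha> / 2 - \<eta>) * y * x' - z * x')"
  by (simp add: nabla_def Let_def)

lemma levi_civita_eq: "levi_civita br g = nabla"
proof (rule levi_civita_eqI[OF sym g_nondegenerate])
  show "bilinear nabla"
    unfolding bilinear_def
  proof (intro conjI allI linearI)
    fix X Y Z and r :: real
    obtain x y z x' y' z' x'' y'' z'' where [simp]:
      "X = vec x y z" "Y = vec x' y' z'" "Z = vec x'' y'' z''"
      by (metis vec_cases)
    show "nabla X (Y + Z) = nabla X Y + nabla X Z" "nabla (Y + Z) X = nabla Y X + nabla Z X"
      "nabla X (r *\<^sub>R Y) = r *\<^sub>R nabla X Y" "nabla (r *\<^sub>R Y) X = r *\<^sub>R nabla Y X"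
      by (simp_all add: nabla_vec vec_arith vec_eq_iff algebra_simps add_divide_distrib)
  qed
next
  fix X Y Z
  obtain x y z x' y' z' x'' y'' z'' where [simp]:
    "X = vec x y z" "Y = vec x' y' z'" "Z = vec x'' y'' z''"
    by (metis vec_cases)
  show "nabla X Y - nabla Y X = br X Y"
    by (simp add: nabla_vec br_vec vec_arith vec_eq_iff algebra_simps)
  show "g (nabla X Y) Z + g Y (nabla X Z) = 0"
    by (simp add: nabla_vec g_vec algebra_simps)
qed

text \<open>Since J is an involution, the canonical connection is the average of
  \<open>nabla X Y\<close> and \<open>J (nabla X (J Y))\<close>, the part of \<open>nabla X\<close>
  commuting with J. Being skew for \<open>g\<close>, it kills \<open>e3\<close> and acts on the
  plane of \<open>e1\<close>, \<open>e2\<close> as an infinitesimal rotation.\<close>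

lemma canonical_connection_vec:
  "canonical_connection br g J (vec x y z) (vec x' y' z') =
     vec (- (y + (\<eta> + \<alpha> / 2) * z) * y') ((y + (\<eta> + \<alpha> / 2) * z) * x') 0"
  by (simp add: canonical_connection_def cov_deriv_endo_def levi_civita_eq
      nabla_vec J_vec vec_arith vec_eq_iff field_simps)

section \<open>The symmetrised Wanas form and its operator\<close>

definition "s1 = -4 + 5 * \<eta> * \<beta> - 2 * \<beta>\<^sup>2 - \<eta> * \<alpha> + \<alpha> * \<beta> / 2"
definition "s2 = -3 + 3 * \<eta> * \<alpha> - 3/2 * \<alpha> * \<beta> + \<eta> * \<beta>"
definition "s3 = -2 + \<alpha>\<^sup>2 / 2 - \<alpha> * \<beta> + 2 * \<eta> * \<beta>"
definition "t = - 3/4 * \<alpha> + \<eta> / 2 + \<beta> / 2"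

text \<open>The constants are the matrix entries of the operator: \<open>e1\<close> goes to
  \<open>s1 e1\<close>, \<open>e2\<close> to \<open>s2 e2 + t e3\<close>, \<open>e3\<close> to
  \<open>- t e2 + s3 e3\<close>. The minus signs at \<open>s3\<close> and \<open>t\<close> reflect
  that \<open>e3\<close> is timelike.\<close>

lemma sym_wanas_form_vec:
  "sym_wanas_form br g J e1 e2 e3 (vec x y z) (vec x' y' z') =
     s1 * x * x' + s2 * y * y' - s3 * z * z' - t * (y * z' + z * y')"
proof -
  \<comment> \<open>Fresh names are needed because \<open>vec\<close> itself depends on
    \<open>e1\<close>, \<open>e2\<close>, \<open>e3\<close>: rewriting \<open>e1\<close> to
    \<open>vec 1 0 0\<close> would not terminate.\<close>
  have "sym_wanas_form br g J a1 a2 a3 (vec x y z) (vec x' y' z') =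
      s1 * x * x' + s2 * y * y' - s3 * z * z' - t * (y * z' + z * y')"
    if a: "a1 = vec 1 0 0" "a2 = vec 0 1 0" "a3 = vec 0 0 1" for a1 a2 a3
    unfolding sym_wanas_form_def wanas_form_def Let_def wanas_tensor_def curvature_def torsion_def
      a canonical_connection_vec br_vec vec_arith g_vec s1_def s2_def s3_def t_def
    using eta by (auto simp: field_simps power2_eq_square)
  then show ?thesis
    by (simp add: vec_unit)
qed

definition wan :: "'a \<Rightarrow> 'a" where
  "wan X = vec (s1 * coord1 X) (s2 * coord2 X - t * coord3 X) (t * coord2 X + s3 * coord3 X)"

lemma wan_vec: "wan (vec x y z) = vec (s1 * x) (s2 * y - t * z) (t * y + s3 * z)"
  by (simp add: wan_def)

lemma wan_diff_vec:
  "wan (vec x y z) - c *\<^sub>R vec x y z =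
     vec ((s1 - c) * x) ((s2 - c) * y - t * z) (t * y + (s3 - c) * z)"
  by (simp add: wan_vec vec_arith vec_eq_iff algebra_simps)

lemma wanas_operator_eq: "wanas_operator br g J e1 e2 e3 = wan"
  unfolding wanas_operator_def
proof (rule the_equality)
  show *: "\<forall>X Y. sym_wanas_form br g J e1 e2 e3 X Y = g (wan X) Y"
  proof (intro allI)
    fix X Y
    obtain x y z x' y' z' where "X = vec x y z" "Y = vec x' y' z'"
      by (metis vec_cases)
    then show "sym_wanas_form br g J e1 e2 e3 X Y = g (wan X) Y"
      by (simp add: sym_wanas_form_vec wan_vec g_vec algebra_simps)
  qed
  fix wan'
  assume "\<forall>X Y. sym_wanas_form br g J e1 e2 e3 X Y = g (wan' X) Y"
  then show "wan' = wan"
    using * by (metis g_nondegenerate ext)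
qed

section \<open>The derivation condition\<close>

lemma derivation_iff:
  "derivation br (\<lambda>X. wan X - c *\<^sub>R X) \<longleftrightarrow>
     (\<alpha> = 0 \<and> \<beta> = \<eta> \<and> c = -1) \<or> (\<alpha> = 0 \<and> \<beta> = - \<eta> \<and> c = -11)"
proof -
  let ?D = "\<lambda>X. wan X - c *\<^sub>R X"
  let ?E = "s1 - c = 2 * t * (\<eta> - \<beta>) \<and>
      2 * t = (2 * \<eta> - \<beta>) * (s3 - s1 - s2 + c) \<and>
      2 * t = \<beta> * (s1 + s3 - s2 - c) \<and>
      \<alpha> * (s2 + s3 - s1 - c) = 0"
  have lin: "linear ?D"
  proof (rule linearI)
    fix X Y and r :: real
    obtain x y z x' y' z' where [simp]: "X = vec x y z" "Y = vec x' y' z'"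
      by (metis vec_cases)
    show "?D (X + Y) = ?D X + ?D Y" "?D (r *\<^sub>R X) = r *\<^sub>R ?D X"
      by (simp_all add: wan_vec vec_arith vec_eq_iff algebra_simps)
  qed
  have "derivation br ?D \<longleftrightarrow> ?E"
  proof
    assume "derivation br ?D"
    then have "?D (br X Y) = br (?D X) Y + br X (?D Y)" for X Y
      by (simp add: derivation_def)
    from this[of "vec 1 0 0" "vec 0 1 0"] this[of "vec 1 0 0" "vec 0 0 1"]
      this[of "vec 0 1 0" "vec 0 0 1"]
    \<comment> \<open>The bracket of \<open>e1\<close>, \<open>e2\<close> yields the first two
      equations, that of \<open>e1\<close>, \<open>e3\<close> the third and again the first, that of
      \<open>e2\<close>, \<open>e3\<close> the fourth.\<close>
    show ?E
      unfolding wan_diff_vec br_vec vec_add vec_eq_iff by (simp add: algebra_simps)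
  next
    assume E: ?E
    have "?D (br X Y) = br (?D X) Y + br X (?D Y)" for X Y
    proof -
      obtain x y z x' y' z' where XY: "X = vec x y z" "Y = vec x' y' z'"
        by (metis vec_cases)
      show ?thesis
        unfolding XY wan_diff_vec br_vec vec_add vec_eq_iff using E by algebra
    qed
    then show "derivation br ?D"
      using lin by (simp add: derivation_def)
  qed
  then show ?thesis
    unfolding s1_def s2_def s3_def t_def soliton_equations_iff[OF eta] .
qed

text \<open>The operator equation leaves a single candidate for \<open>D\<close>, so both the
  existence of a soliton and the explicit values of \<open>D\<close> can be read off from this
  equivalence.\<close>

lemma wanas_decomposition_iff:
  "wanas_decomposition br g J e1 e2 e3 c D \<longleftrightarrow>
     D = (\<lambda>X. wan X - c *\<^sub>R X) \<and>
     ((\<alpha> = 0 \<and> \<beta> = \<eta> \<and> c = -1) \<or> (\<alpha> = 0 \<and> \<beta> = - \<eta> \<and> c = -11))"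
proof -
  have "(\<forall>X. wan X = c *\<^sub>R X + D X) \<longleftrightarrow> D = (\<lambda>X. wan X - c *\<^sub>R X)"
    by (auto simp: fun_eq_iff algebra_simps)
  then show ?thesis
    unfolding wanas_decomposition_def wanas_operator_eq by (metis derivation_iff)
qed

end

theorem theorem2p16:
  fixes br :: "'a::real_vector \<Rightarrow> 'a \<Rightarrow> 'a"
    and g :: "'a \<Rightarrow> 'a \<Rightarrow> real"
    and J :: "'a \<Rightarrow> 'a"
    and e1 e2 e3 :: 'a
    and \<alpha> \<beta> \<eta> c :: real
  assumes "\<eta> \<in> {1, -1}"
    and "lie_bracket br"
    and "symmetric_form g"
    and "pseudo_orthonormal_basis g e1 e2 e3"
    and "br e1 e2 = - e2 + (2 * \<eta> - \<beta>) *\<^sub>R e3"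
    and "br e1 e3 = - (\<beta> *\<^sub>R e2) + e3"
    and "br e2 e3 = \<alpha> *\<^sub>R e1"
    and "linear J"
    and "J e1 = e1" and "J e2 = e2" and "J e3 = - e3"
  shows "(second_kind_wanas_soliton br g J e1 e2 e3 c \<longleftrightarrow>
            (\<alpha> = 0 \<and> \<beta> = \<eta> \<and> c = -1) \<or> (\<alpha> = 0 \<and> \<beta> = - \<eta> \<and> c = -11)) \<and>
         (\<forall>D. wanas_decomposition br g J e1 e2 e3 c D \<longrightarrow>
            (\<alpha> = 0 \<and> \<beta> = \<eta> \<and> c = -1 \<longrightarrow>
               D e1 = 0 \<and> D e2 = - e2 + \<eta> *\<^sub>R e3 \<and> D e3 = - (\<eta> *\<^sub>R e2) + e3) \<and>
            (\<alpha> = 0 \<and> \<beta> = - \<eta> \<and> c = -11 \<longrightarrow>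
               D e1 = 0 \<and> D e2 = 7 *\<^sub>R e2 \<and> D e3 = 7 *\<^sub>R e3))"
proof -
  interpret lorentzian_G4 g e1 e2 e3 br J \<alpha> \<beta> \<eta>
    using assms by (intro lorentzian_G4.intro pseudo_orthonormal_frame.intro lorentzian_G4_axioms.intro)
  note wan_diff_basis = wan_diff_vec[of 1 0 0, unfolded vec_unit]
    wan_diff_vec[of 0 1 0, unfolded vec_unit] wan_diff_vec[of 0 0 1, unfolded vec_unit]
  \<comment> \<open>Here \<open>s1 - c = 0\<close>, \<open>s2 - c = -1\<close>,
    \<open>s3 - c = 1\<close> and \<open>t\<close> equals \<eta>. In the second case
    \<open>s1 - c = t = 0\<close> and \<open>s2 - c = s3 - c = 7\<close>.\<close>
  have "D e1 = 0 \<and> D e2 = - e2 + \<eta> *\<^sub>R e3 \<and> D e3 = - (\<eta> *\<^sub>R e2) + e3"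
    if "D = (\<lambda>X. wan X - c *\<^sub>R X)" "\<alpha> = 0" "\<beta> = \<eta>" "c = -1" for D
    unfolding that(1) wan_diff_basis s1_def s2_def s3_def t_def vec_def
    using eta that(2-) by auto
  moreover have "D e1 = 0 \<and> D e2 = 7 *\<^sub>R e2 \<and> D e3 = 7 *\<^sub>R e3"
    if "D = (\<lambda>X. wan X - c *\<^sub>R X)" "\<alpha> = 0" "\<beta> = - \<eta>" "c = -11" for D
    unfolding that(1) wan_diff_basis s1_def s2_def s3_def t_def vec_def
    using eta that(2-) by auto
  ultimately show ?thesis
    unfolding second_kind_wanas_soliton_def wanas_decomposition_iff by blast
qed

end
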